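(* Let $n\ge k\ge1$ be integers. If $A$ is a symmetric $(-1,1)$-matrix of order $n$ with $\lambda_{k}^{\ast}(A)=n/\sqrt{k}$, then $$c_{k+1}^{\ast}=\frac{1}{2\sqrt{k}}.$$
   Context: A $(-1,1)$-matrix is a matrix all of whose entries are $-1$ or $1$; the order of a square matrix is its number of rows. For a real symmetric matrix $A$ of order $n$, $\lambda_1^{\ast}(A)\ge\cdots\ge\lambda_n^{\ast}(A)$ denote its singular values (the absolute values of its eigenvalues in nonincreasing order). Graphs are finite, simple and undirected, and for a graph $G$ of order (number of vertices) $n$, $\lambda_i^{\ast}(G)$ denotes the $i$'th largest singular value of its adjacency matrix. For an integer $j\ge 1$, $$c_{j}^{\ast}=\sup\{\lambda_{j}^{\ast}(G)/n: G\text{ is a graph of order }n\ge j\}.$$ *)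

theory Defs
  imports
    "HOL-Computational_Algebra.Polynomial"
    "Jordan_Normal_Form.Char_Poly"
    "Graph_Theory.Pair_Digraph"
begin

text \<open>
  Eigenvalues are taken with multiplicity, as the multiset of roots of the characteristic
  polynomial. Only real roots are seen, so the definition gives the singular values for
  symmetric (more generally, for normal matrices with real spectrum) matrices only; for a
  symmetric matrix of order n the list has length n. The index i runs from 1 to n.
\<close>
definition sym_singular_values :: "real mat \<Rightarrow> real list" where
  "sym_singular_values A =
     rev (sorted_list_of_multiset (image_mset abs (proots (char_poly A))))"

definition sym_singular_value :: "nat \<Rightarrow> real mat \<Rightarrow> real" where
  "sym_singular_value i A = sym_singular_values A ! (i - 1)"

text \<open>
  The predicate \<^const>\<open>pair_graph\<close> describes finite simple undirected graphs, the edge set being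
  a symmetric irreflexive relation on a finite vertex set. Rows and columns of the adjacency
  matrix are indexed by the vertices in increasing order; any other enumeration gives a similar
  matrix. Vertices are natural numbers, which covers all finite graphs up to isomorphism.
\<close>
definition adjacency_mat :: "nat pair_pre_digraph \<Rightarrow> real mat" where
  "adjacency_mat G =
     (let vs = sorted_list_of_set (pverts G)
      in mat (card (pverts G)) (card (pverts G))
           (\<lambda>(i, j). if (vs ! i, vs ! j) \<in> parcs G then 1 else 0))"

definition graph_singular_value :: "nat \<Rightarrow> nat pair_pre_digraph \<Rightarrow> real" where
  "graph_singular_value i G = sym_singular_value i (adjacency_mat G)"

definition c_star :: "nat \<Rightarrow> real" where
  "c_star j = Sup {graph_singular_value j G / real (card (pverts G)) | G.
                     pair_graph G \<and> card (pverts G) \<ge> j}"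

end

theory Submission
  imports Defs "HOL-Analysis.L2_Norm" "HOL-Combinatorics.Permutations"
begin

text \<open>
  Write \<open>\<sigma>\<^sub>i\<close> for the \<open>i\<close>-th largest singular value and \<open>J\<close> for the all-ones matrix.

  Upper bound. Let \<open>B\<close> be the adjacency matrix of a graph of order \<open>m\<close>. The matrix \<open>S = J - 2B\<close>
  has entries \<open>\<plusminus>1\<close> and agrees with \<open>-2B\<close> on the hyperplane orthogonal to the all-ones vector.
  Restricting to a hyperplane costs one index, so \<open>2 \<sigma>\<^sub>k\<^sub>+\<^sub>1(B) \<le> \<sigma>\<^sub>k(S)\<close>
  (\<open>singular_value_interlacing\<close>). The squares of the singular values of \<open>S\<close> sum to its squared
  Frobenius norm \<open>m\<^sup>2\<close>, hence \<open>k \<sigma>\<^sub>k(S)\<^sup>2 \<le> m\<^sup>2\<close> and \<open>\<sigma>\<^sub>k\<^sub>+\<^sub>1(B) \<le> m / (2 sqrt k)\<close>.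

  Lower bound. Let \<open>v = (1, -1, 1, -1, \<dots>)\<close> have length \<open>2t\<close> and blow \<open>A\<close> up to the \<open>\<plusminus>1\<close> matrix
  \<open>S = v v\<^sup>T \<otimes> A\<close> of order \<open>m = 2tn\<close>. As \<open>v\<close> sums to zero, so do the rows of \<open>S\<close>; therefore \<open>J\<close> and \<open>S\<close>
  do not interfere, and \<open>(J + S) / 2\<close> has the eigenvalue \<open>m / 2\<close> together with the \<open>t \<lambda>\<close>, for \<open>\<lambda>\<close> an
  eigenvalue of \<open>A\<close>. If \<open>\<sigma>\<^sub>k(A) = n / sqrt k\<close>, then at least \<open>k + 1\<close> of these have absolute value at
  least \<open>m / (2 sqrt k)\<close>. The matrix \<open>(J + S) / 2\<close> is symmetric with entries 0 and 1; deleting its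
  diagonal leaves the adjacency matrix of a graph and moves singular values by at most 1
  (\<open>singular_value_ge_perturbed\<close>). Dividing by \<open>m\<close> and letting \<open>t\<close> grow gives the bound.

  Both comparisons of singular values, on a hyperplane and under perturbation, come from one min-max
  principle, \<open>singular_value_ge\<close>, which in turn rests on an orthonormal eigenbasis sorted by absolute
  eigenvalue (\<open>singular_values_eigenbasis\<close>).
\<close>

section \<open>Diagonalisation of real symmetric matrices\<close>

text \<open>
  A complex eigenvector \<open>v\<close> with eigenvalue \<open>z\<close> gives \<open>v\<^sup>* A v = z |v|\<^sup>2\<close>. By symmetry the left-hand
  side equals its own conjugate, so \<open>z\<close> is real.
\<close>
lemma symmetric_mat_has_eigenvalue:
  fixes A :: "real mat"
  assumes A: "A \<in> carrier_mat n n" and sym: "transpose_mat A = A" and n: "n > 0"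
  shows "\<exists>e. eigenvalue A e"
proof -
  let ?h = "of_real :: real \<Rightarrow> complex"
  let ?B = "map_mat ?h A"
  have B: "?B \<in> carrier_mat n n" using A by simp
  obtain as where as: "char_poly ?B = (\<Prod>a\<leftarrow>as. [:- a, 1:])" "length as = n"
    using char_poly_factorized[OF B] by blast
  obtain z where z: "poly (char_poly ?B) z = 0"
  proof -
    have "hd as \<in> set as" using as(2) n by (cases as) auto
    then have "poly (char_poly ?B) (hd as) = 0"
      unfolding as(1) by (auto simp: poly_prod_list prod_list_zero_iff)
    then show thesis using that by blast
  qed
  then have "eigenvalue ?B z" using eigenvalue_root_char_poly[OF B] by blast
  then obtain v where v: "v \<in> carrier_vec n" "v \<noteq> 0\<^sub>v n" "?B *\<^sub>v v = z \<cdot>\<^sub>v v"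
    using B unfolding eigenvalue_def eigenvector_def by auto
  have Bv: "(\<Sum>b<n. ?h (A $$ (a, b)) * v $ b) = z * v $ a" if "a < n" for a
  proof -
    have "(?B *\<^sub>v v) $ a = (\<Sum>b<n. ?h (A $$ (a, b)) * v $ b)"
      using that A v(1) by (auto simp: scalar_prod_def lessThan_atLeast0 intro!: sum.cong)
    then show ?thesis using v(1,3) that by simp
  qed
  have A_swap: "A $$ (a, b) = A $$ (b, a)" if "a < n" "b < n" for a b
    using arg_cong[OF sym, of "\<lambda>M. M $$ (a, b)"] A that by simp
  define q where "q = (\<Sum>a<n. \<Sum>b<n. cnj (v $ a) * ?h (A $$ (a, b)) * v $ b)"
  define r where "r = (\<Sum>a<n. (cmod (v $ a))\<^sup>2)"
  have q: "q = z * ?h r"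
  proof -
    have "q = (\<Sum>a<n. cnj (v $ a) * (\<Sum>b<n. ?h (A $$ (a, b)) * v $ b))"
      unfolding q_def by (simp add: sum_distrib_left mult.assoc)
    also have "\<dots> = (\<Sum>a<n. z * ?h ((cmod (v $ a))\<^sup>2))"
    proof (intro sum.cong refl)
      fix a assume "a \<in> {..<n}"
      then have "(\<Sum>b<n. ?h (A $$ (a, b)) * v $ b) = z * v $ a" by (simp add: Bv)
      moreover have "v $ a * cnj (v $ a) = ?h ((cmod (v $ a))\<^sup>2)" by (rule complex_norm_square[symmetric])
      ultimately show "cnj (v $ a) * (\<Sum>b<n. ?h (A $$ (a, b)) * v $ b) = z * ?h ((cmod (v $ a))\<^sup>2)"
        by (simp add: mult.commute mult.left_commute)
    qed
    finally show ?thesis unfolding r_def by (simp add: sum_distrib_left)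
  qed
  have "cnj q = q"
  proof -
    have "cnj q = (\<Sum>a<n. \<Sum>b<n. cnj (v $ b) * ?h (A $$ (a, b)) * v $ a)"
      unfolding q_def by (simp add: mult_ac)
    also have "\<dots> = (\<Sum>b<n. \<Sum>a<n. cnj (v $ b) * ?h (A $$ (a, b)) * v $ a)"
      by (rule sum.swap)
    also have "\<dots> = q" unfolding q_def by (intro sum.cong refl) (simp add: A_swap)
    finally show ?thesis .
  qed
  moreover have "r \<noteq> 0"
  proof
    assume "r = 0"
    then have "\<forall>a<n. v $ a = 0" unfolding r_def by (simp add: sum_nonneg_eq_0_iff)
    then have "v = 0\<^sub>v n" using v(1) by (intro eq_vecI) auto
    then show False using v(2) by simp
  qed
  ultimately have "cnj z = z" unfolding q by simp
  then have z_real: "z = ?h (Re z)" by (metis Reals_cnj_iff of_real_Re)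
  have "char_poly ?B = map_poly ?h (char_poly A)" by (rule of_real_hom.char_poly_hom[OF A])
  then have "?h (poly (char_poly A) (Re z)) = 0"
    using z z_real by (metis of_real_hom.poly_map_poly)
  then show ?thesis using eigenvalue_root_char_poly[OF A] by auto
qed

text \<open>
  The Householder reflection in the hyperplane orthogonal to \<open>w = v - e\<^sub>0\<close> exchanges \<open>v\<close> and the
  first unit vector \<open>e\<^sub>0\<close>.
\<close>
lemma orthogonal_mat_with_first_column:
  fixes v :: "real vec"
  assumes v: "v \<in> carrier_vec n" "v \<bullet> v = 1" and n: "n > 0"
  obtains H where "H \<in> carrier_mat n n" "transpose_mat H = H" "H * H = 1\<^sub>m n"
    "H *\<^sub>v unit_vec n 0 = v"
proof -
  define w where "w a = v $ a - (if a = 0 then 1 else 0)" for a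
  define q where "q = (\<Sum>a<n. (w a)\<^sup>2)"
  \<comment> \<open>If \<open>v\<close> is already the first unit vector, then \<open>q = 0\<close>, so \<open>c = 2 / 0 = 0\<close> and the reflection
    degenerates to the identity, as it should.\<close>
  define c where "c = 2 / q"
  define H where "H = mat n n (\<lambda>(a, b). (if a = b then 1 else 0) - c * w a * w b)"
  have vv: "(\<Sum>a<n. (v $ a)\<^sup>2) = 1"
    using v by (simp add: scalar_prod_def lessThan_atLeast0 power2_eq_square)
  have q: "q = 2 - 2 * v $ 0"
  proof -
    have "q = (\<Sum>a<n. (v $ a)\<^sup>2 + (if a = 0 then 1 - 2 * v $ 0 else 0))"
      unfolding q_def w_def by (intro sum.cong refl) (auto simp: power2_eq_square algebra_simps)
    then show ?thesis using vv n by (simp add: sum.distrib)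
  qed
  have cq: "c * c * q = 2 * c" unfolding c_def by simp
  have cw: "c * w 0 * w a = - w a" if "a < n" for a
  proof (cases "q = 0")
    case True
    then have "w a = 0" using that unfolding q_def by (simp add: sum_nonneg_eq_0_iff)
    then show ?thesis by simp
  next
    case False
    then have "c * w 0 = - 1" using q unfolding c_def w_def by (simp add: field_simps)
    then show ?thesis by simp
  qed
  have HC: "H \<in> carrier_mat n n" unfolding H_def by simp
  moreover have "transpose_mat H = H" unfolding H_def by (intro eq_matI) auto
  moreover have "H * H = 1\<^sub>m n"
  proof (intro eq_matI)
    fix a b assume ab: "a < dim_row (1\<^sub>m n)" "b < dim_col (1\<^sub>m n)"
    have "(H * H) $$ (a, b) = (\<Sum>d<n. ((if a = d then 1 else 0) - c * w a * w d)
        * ((if d = b then 1 else 0) - c * w d * w b))"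
      using ab unfolding H_def by (simp add: scalar_prod_def lessThan_atLeast0)
    also have "\<dots> = (\<Sum>d<n. (if a = d then (if d = b then 1 else 0) - c * w d * w b else 0)
        + ((if d = b then - c * w a * w b else 0) + c * c * w a * w b * (w d)\<^sup>2))"
      by (intro sum.cong refl) (auto simp: algebra_simps power2_eq_square)
    also have "\<dots> = (if a = b then 1 else 0) - c * w a * w b - c * w a * w b + c * c * w a * w b * q"
      using ab unfolding q_def sum.distrib by (simp add: sum_distrib_left)
    also have "\<dots> = (if a = b then 1 else 0) + (c * c * q - 2 * c) * (w a * w b)"
      by (simp add: algebra_simps)
    also have "\<dots> = (1\<^sub>m n) $$ (a, b)" using ab cq by simp
    finally show "(H * H) $$ (a, b) = (1\<^sub>m n) $$ (a, b)" .
  qed (use HC in auto)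
  moreover have "H *\<^sub>v unit_vec n 0 = v"
  proof (intro eq_vecI)
    fix a assume a: "a < dim_vec v"
    have "(H *\<^sub>v unit_vec n 0) $ a = (if a = 0 then 1 else 0) - c * w 0 * w a"
      using a n v unfolding H_def by (simp add: scalar_prod_right_unit[of _ n] mult_ac)
    also have "\<dots> = v $ a" using a v cw[of a] by (simp add: w_def)
    finally show "(H *\<^sub>v unit_vec n 0) $ a = v $ a" .
  qed (use HC v in auto)
  ultimately show thesis using that by blast
qed
text \<open>
  Induction on the order: conjugating with an orthogonal matrix whose first column is a unit
  eigenvector clears the first column and, by symmetry, the first row outside the diagonal.
  The remaining block is symmetric of smaller order.
\<close>
theorem symmetric_mat_diagonalisation:
  fixes A :: "real mat"
  assumes "A \<in> carrier_mat n n" "transpose_mat A = A"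
  shows "\<exists>U D. U \<in> carrier_mat n n \<and> D \<in> carrier_mat n n \<and> diagonal_mat D
    \<and> U * transpose_mat U = 1\<^sub>m n \<and> A = U * D * transpose_mat U"
  using assms
proof (induction n arbitrary: A)
  case 0
  show ?case by (rule exI[of _ "1\<^sub>m 0"], rule exI[of _ A]) (use 0 in \<open>auto simp: diagonal_mat_def\<close>)
next
  case (Suc n)
  note A = Suc.prems(1) and sym = Suc.prems(2)
  obtain e where "eigenvalue A e" using symmetric_mat_has_eigenvalue[OF A sym] by blast
  then obtain v0 where v0: "v0 \<in> carrier_vec (Suc n)" "v0 \<noteq> 0\<^sub>v (Suc n)" "A *\<^sub>v v0 = e \<cdot>\<^sub>v v0"
    using A unfolding eigenvalue_def eigenvector_def by auto
  have pos: "v0 \<bullet> v0 > 0"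
  proof -
    have eq: "v0 \<bullet> v0 = (\<Sum>a<Suc n. (v0 $ a)\<^sup>2)"
      using v0(1) by (simp add: scalar_prod_def lessThan_atLeast0 power2_eq_square)
    have "v0 \<bullet> v0 \<noteq> 0"
    proof
      assume "v0 \<bullet> v0 = 0"
      then have "\<forall>a\<in>{..<Suc n}. (v0 $ a)\<^sup>2 = 0"
        unfolding eq by (subst (asm) sum_nonneg_eq_0_iff) auto
      then have "v0 = 0\<^sub>v (Suc n)" using v0(1) by (intro eq_vecI) auto
      then show False using v0(2) by simp
    qed
    moreover have "v0 \<bullet> v0 \<ge> 0" unfolding eq by (intro sum_nonneg) simp
    ultimately show ?thesis by simp
  qed
  define v where "v = (1 / sqrt (v0 \<bullet> v0)) \<cdot>\<^sub>v v0"
  have v: "v \<in> carrier_vec (Suc n)" using v0(1) unfolding v_def by simp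
  have vv: "v \<bullet> v = 1"
    using v0(1) pos unfolding v_def by (simp add: field_simps)
  have Av: "A *\<^sub>v v = e \<cdot>\<^sub>v v"
    using A v0 unfolding v_def
    by (simp add: mult_mat_vec[of A "Suc n" "Suc n"] smult_smult_assoc mult.commute)
  obtain H where H: "H \<in> carrier_mat (Suc n) (Suc n)" "transpose_mat H = H" "H * H = 1\<^sub>m (Suc n)"
    "H *\<^sub>v unit_vec (Suc n) 0 = v"
    using orthogonal_mat_with_first_column[OF v vv] by blast
  define B where "B = H * A * H"
  have B: "B \<in> carrier_mat (Suc n) (Suc n)" unfolding B_def using A H by simp
  have B_sym: "transpose_mat B = B"
    unfolding B_def using A H sym
    by (simp add: transpose_mult[of _ "Suc n" "Suc n" _ "Suc n"] assoc_mult_mat[of _ "Suc n" "Suc n" _ "Suc n" _ "Suc n"])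
  have B_col: "B *\<^sub>v unit_vec (Suc n) 0 = e \<cdot>\<^sub>v unit_vec (Suc n) 0"
  proof -
    have "H *\<^sub>v v = H * H *\<^sub>v unit_vec (Suc n) 0"
      using H(1,4) by (metis assoc_mult_mat_vec unit_vec_carrier)
    then have Hv: "H *\<^sub>v v = unit_vec (Suc n) 0" using H(3) by simp
    have "B *\<^sub>v unit_vec (Suc n) 0 = H *\<^sub>v (A *\<^sub>v (H *\<^sub>v unit_vec (Suc n) 0))"
      unfolding B_def using A H(1)
      by (simp add: assoc_mult_mat_vec[of _ "Suc n" "Suc n" _ "Suc n"])
    then show ?thesis using H(1,4) Av Hv v by (simp add: mult_mat_vec[of H "Suc n" "Suc n"])
  qed
  have B_col0: "B $$ (a, 0) = (if a = 0 then e else 0)" if "a < Suc n" for a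
  proof -
    have "B $$ (a, 0) = (B *\<^sub>v unit_vec (Suc n) 0) $ a"
      using that B by (simp add: scalar_prod_right_unit[of _ "Suc n"])
    then show ?thesis using that unfolding B_col by simp
  qed
  have B_swap: "B $$ (a, b) = B $$ (b, a)" if "a < Suc n" "b < Suc n" for a b
    using arg_cong[OF B_sym, of "\<lambda>M. M $$ (a, b)"] B that by simp
  define A' where "A' = mat n n (\<lambda>(a, b). B $$ (Suc a, Suc b))"
  have A': "A' \<in> carrier_mat n n" "transpose_mat A' = A'"
    unfolding A'_def by (auto intro!: eq_matI simp: B_swap)
  have B_block: "B = four_block_mat (e \<cdot>\<^sub>m 1\<^sub>m 1) (0\<^sub>m 1 n) (0\<^sub>m n 1) A'"
  proof (intro eq_matI)
    fix a b assume "a < dim_row (four_block_mat (e \<cdot>\<^sub>m 1\<^sub>m 1) (0\<^sub>m 1 n) (0\<^sub>m n 1) A')"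
      "b < dim_col (four_block_mat (e \<cdot>\<^sub>m 1\<^sub>m 1) (0\<^sub>m 1 n) (0\<^sub>m n 1) A')"
    then have ab: "a < Suc n" "b < Suc n" unfolding A'_def by auto
    then show "B $$ (a, b) = four_block_mat (e \<cdot>\<^sub>m 1\<^sub>m 1) (0\<^sub>m 1 n) (0\<^sub>m n 1) A' $$ (a, b)"
      using B_col0[of a] B_col0[of b] B_swap[of a b] unfolding A'_def by auto
  qed (use B in \<open>auto simp: A'_def\<close>)
  obtain U' D' where IH: "U' \<in> carrier_mat n n" "D' \<in> carrier_mat n n" "diagonal_mat D'"
    "U' * transpose_mat U' = 1\<^sub>m n" "A' = U' * D' * transpose_mat U'"
    using Suc.IH[OF A'] by blast
  define W where "W = four_block_mat (1\<^sub>m 1) (0\<^sub>m 1 n) (0\<^sub>m n 1) U'"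
  define D where "D = four_block_mat (e \<cdot>\<^sub>m 1\<^sub>m 1) (0\<^sub>m 1 n) (0\<^sub>m n 1) D'"
  have W: "W \<in> carrier_mat (Suc n) (Suc n)" and D: "D \<in> carrier_mat (Suc n) (Suc n)"
    unfolding W_def D_def using IH(1,2) by auto
  have Wt: "transpose_mat W = four_block_mat (1\<^sub>m 1) (0\<^sub>m 1 n) (0\<^sub>m n 1) (transpose_mat U')"
    unfolding W_def using IH(1) by (subst transpose_four_block_mat) auto
  have Ut': "transpose_mat U' \<in> carrier_mat n n" using IH(1) by simp
  have W_orth: "W * transpose_mat W = 1\<^sub>m (Suc n)"
    unfolding Wt unfolding W_def using IH(1,4) Ut'
    by (subst mult_four_block_mat[of _ 1 1 _ n _ n]) (auto simp: four_block_one_mat[of 1 n, simplified])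
  have B_diag: "B = W * D * transpose_mat W"
  proof -
    have "W * D = four_block_mat (e \<cdot>\<^sub>m 1\<^sub>m 1) (0\<^sub>m 1 n) (0\<^sub>m n 1) (U' * D')"
      unfolding W_def D_def using IH(1,2) by (subst mult_four_block_mat[of _ 1 1 _ n _ n]) auto
    then show ?thesis unfolding B_block IH(5) Wt using IH(1,2) Ut'
      by (simp, subst mult_four_block_mat[of _ 1 1 _ n _ n]) auto
  qed
  define U where "U = H * W"
  have U: "U \<in> carrier_mat (Suc n) (Suc n)" unfolding U_def using H(1) W by simp
  have Wt_carr: "transpose_mat W \<in> carrier_mat (Suc n) (Suc n)" using W by simp
  have Ut: "transpose_mat U = transpose_mat W * H"
    unfolding U_def using H(1,2) W by (simp add: transpose_mult[of _ "Suc n" "Suc n" _ "Suc n"])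
  note assoc = assoc_mult_mat[of _ "Suc n" "Suc n" _ "Suc n" _ "Suc n"]
  have "U * transpose_mat U = H * (W * transpose_mat W) * H"
    unfolding Ut unfolding U_def using H(1) W Wt_carr by (simp add: assoc)
  then have "U * transpose_mat U = 1\<^sub>m (Suc n)" using W_orth H(1,3) by simp
  moreover have "U * D * transpose_mat U = A"
  proof -
    have "U * D * transpose_mat U = H * (W * D * transpose_mat W) * H"
      unfolding Ut unfolding U_def using H(1) W Wt_carr D by (simp add: assoc)
    also have "\<dots> = (H * H) * A * (H * H)"
      unfolding B_diag[symmetric] B_def using H(1) A by (simp add: assoc)
    also have "\<dots> = A" using H(3) A by simp
    finally show ?thesis .
  qed
  moreover have "diagonal_mat D"
    using IH(2,3) unfolding D_def diagonal_mat_def by auto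
  ultimately show ?case using U D by (intro exI[of _ U] exI[of _ D]) auto
qed

section \<open>Sorted orthonormal eigenbases\<close>

text \<open>
  Vectors are functions on indices, of which only those below the order of the matrix matter. Vectors
  that are assembled from blocks or linear combinations then need no dimension bookkeeping.
\<close>
definition mat_apply :: "real mat \<Rightarrow> (nat \<Rightarrow> real) \<Rightarrow> nat \<Rightarrow> real" where
  "mat_apply A x a = (\<Sum>b<dim_col A. A $$ (a, b) * x b)"

definition orthonormal :: "nat \<Rightarrow> nat \<Rightarrow> (nat \<Rightarrow> nat \<Rightarrow> real) \<Rightarrow> bool" where
  "orthonormal m r z \<longleftrightarrow> (\<forall>i<r. \<forall>j<r. (\<Sum>a<m. z i a * z j a) = (if i = j then 1 else 0))"

definition sq_norm :: "nat \<Rightarrow> (nat \<Rightarrow> real) \<Rightarrow> real" where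
  "sq_norm m x = (\<Sum>a<m. (x a)\<^sup>2)"

lemma orthonormalD: "orthonormal m r z \<Longrightarrow> i < r \<Longrightarrow> j < r \<Longrightarrow>
    (\<Sum>a<m. z i a * z j a) = (if i = j then 1 else 0)"
  by (simp add: orthonormal_def)

lemma proots_prod_list_linear: "proots (\<Prod>a\<leftarrow>as. [:- a, 1:]) = mset (as :: real list)"
proof (induction as)
  case (Cons a as)
  have "(\<Prod>a\<leftarrow>as. [:- a, 1:]) \<noteq> (0 :: real poly)" by (auto simp: prod_list_zero_iff)
  then have "proots ([:- a, 1:] * (\<Prod>a\<leftarrow>as. [:- a, 1:])) = add_mset a (mset as)"
    by (subst proots_mult) (auto simp: Cons.IH)
  then show ?case by (simp only: list.map prod_list.Cons mset.simps)
qed simp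

text \<open>
  The columns of the diagonalising matrix, permuted so that the absolute eigenvalues decrease. The
  \<open>Suc\<close> reconciles indices of vectors, which start at 0, with those of singular values, which start at 1.
  The second property is completeness of the basis (orthonormal rows), the first
  orthonormality (orthonormal columns).
\<close>
lemma singular_values_eigenbasis:
  assumes A: "A \<in> carrier_mat n n" and sym: "transpose_mat A = A"
  obtains u l where "orthonormal n n u"
    "\<And>a b. a < n \<Longrightarrow> b < n \<Longrightarrow> (\<Sum>i<n. u i a * u i b) = (if a = b then 1 else 0)"
    "\<And>i a. i < n \<Longrightarrow> a < n \<Longrightarrow> mat_apply A (u i) a = l i * u i a"
    "\<And>i. i < n \<Longrightarrow> sym_singular_value (Suc i) A = \<bar>l i\<bar>"
    "\<And>i j. i \<le> j \<Longrightarrow> j < n \<Longrightarrow> \<bar>l j\<bar> \<le> \<bar>l i\<bar>"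
proof -
  obtain U D where UD: "U \<in> carrier_mat n n" "D \<in> carrier_mat n n" "diagonal_mat D"
    "U * transpose_mat U = 1\<^sub>m n" "A = U * D * transpose_mat U"
    using symmetric_mat_diagonalisation[OF A sym] by blast
  have UtU: "transpose_mat U * U = 1\<^sub>m n"
    using mat_mult_left_right_inverse[OF UD(1) _ UD(4)] UD(1) by simp
  define es where "es = diag_mat D"
  have len: "length es = n" using UD(2) by (simp add: es_def diag_mat_def)
  have D: "D $$ (a, b) = (if a = b then es ! a else 0)" if "a < n" "b < n" for a b
    using that UD(2,3) by (auto simp: es_def diag_mat_def diagonal_mat_def)
  have "similar_mat A D"
    unfolding similar_mat_def similar_mat_wit_def Let_def
    using UD UtU A by (intro exI[of _ U] exI[of _ "transpose_mat U"]) auto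
  then have "char_poly A = char_poly D" by (rule char_poly_similar)
  also have "\<dots> = (\<Prod>a\<leftarrow>es. [:- a, 1:])"
    unfolding es_def using UD(2,3)
    by (intro char_poly_upper_triangular) (auto simp: upper_triangular_def diagonal_mat_def)
  finally have "proots (char_poly A) = mset es" by (simp add: proots_prod_list_linear)
  then have sv: "sym_singular_values A = rev (sort (map abs es))"
    by (simp add: sym_singular_values_def flip: mset_map)
  have "mset (sym_singular_values A) = mset (map abs es)" unfolding sv by simp
  from mset_eq_permutation[OF this] obtain p where
    p: "p permutes {..<length (map abs es)}" "permute_list p (map abs es) = sym_singular_values A"
    by blast
  have p_lt: "p i < n" if "i < n" for i using permutes_in_image[OF p(1)] that len by simp
  have sv_nth: "sym_singular_values A ! i = \<bar>es ! p i\<bar>" if "i < n" for i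
    using permute_list_nth[OF p(1)] that len p_lt[OF that] by (simp flip: p(2))
  define u where "u i a = U $$ (a, p i)" for i a
  define l where "l i = es ! p i" for i
  have bij: "bij_betw p {..<n} {..<n}" using permutes_imp_bij[OF p(1)] len by simp
  have UtU_entry: "(\<Sum>a<n. U $$ (a, i) * U $$ (a, j)) = (if i = j then 1 else 0)" if "i < n" "j < n" for i j
    using arg_cong[OF UtU, of "\<lambda>M. M $$ (i, j)"] UD(1) that
    by (simp add: scalar_prod_def lessThan_atLeast0)
  have UUt_entry: "(\<Sum>i<n. U $$ (a, i) * U $$ (b, i)) = (if a = b then 1 else 0)" if "a < n" "b < n" for a b
    using arg_cong[OF UD(4), of "\<lambda>M. M $$ (a, b)"] UD(1) that
    by (simp add: scalar_prod_def lessThan_atLeast0)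
  have AU: "A * U = U * D"
    using UD(1,2) UtU unfolding UD(5) by (simp add: assoc_mult_mat[of _ n n _ n _ n])
  have AU_entry: "(\<Sum>b<n. A $$ (a, b) * U $$ (b, i)) = es ! i * U $$ (a, i)" if "a < n" "i < n" for a i
  proof -
    have "(\<Sum>b<n. A $$ (a, b) * U $$ (b, i)) = (A * U) $$ (a, i)"
      using A UD(1) that by (simp add: scalar_prod_def lessThan_atLeast0)
    also have "\<dots> = (\<Sum>b<n. U $$ (a, b) * D $$ (b, i))"
      unfolding AU using UD(1,2) that by (simp add: scalar_prod_def lessThan_atLeast0)
    also have "\<dots> = (\<Sum>b<n. if b = i then U $$ (a, i) * es ! i else 0)"
      using that by (intro sum.cong refl) (auto simp: D)
    finally show ?thesis using that by (simp add: mult.commute)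
  qed
  show thesis
  proof (rule that[of u l])
    show "orthonormal n n u"
      unfolding orthonormal_def u_def
      using permutes_inj[OF p(1)] by (auto simp: UtU_entry p_lt inj_eq)
    show "(\<Sum>i<n. u i a * u i b) = (if a = b then 1 else 0)" if "a < n" "b < n" for a b
      unfolding u_def using sum.reindex_bij_betw[OF bij, of "\<lambda>i. U $$ (a, i) * U $$ (b, i)"]
      by (simp add: UUt_entry that)
    show "mat_apply A (u i) a = l i * u i a" if "i < n" "a < n" for i a
      unfolding mat_apply_def u_def l_def using A by (simp add: AU_entry p_lt that)
    show "sym_singular_value (Suc i) A = \<bar>l i\<bar>" if "i < n" for i
      unfolding sym_singular_value_def l_def by (simp add: sv_nth that)
    show "\<bar>l j\<bar> \<le> \<bar>l i\<bar>" if "i \<le> j" "j < n" for i j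
    proof -
      have "sorted_wrt (\<ge>) (sym_singular_values A)"
        unfolding sv by (simp add: sorted_wrt_rev)
      then have "sym_singular_values A ! j \<le> sym_singular_values A ! i"
        using that len unfolding sv by (cases "i = j") (auto simp: sorted_wrt_iff_nth_less)
      then show ?thesis using that by (simp add: sv_nth l_def)
    qed
  qed
qed

section \<open>Linear combinations of orthonormal vectors\<close>

definition lin_comb :: "nat \<Rightarrow> (nat \<Rightarrow> real) \<Rightarrow> (nat \<Rightarrow> nat \<Rightarrow> real) \<Rightarrow> nat \<Rightarrow> real" where
  "lin_comb r c z a = (\<Sum>i<r. c i * z i a)"

lemma orthonormal_mono: "orthonormal m r z \<Longrightarrow> r' \<le> r \<Longrightarrow> orthonormal m r' z"
  by (simp add: orthonormal_def)

lemma sq_norm_nonneg [simp]: "sq_norm m x \<ge> 0"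
  by (simp add: sq_norm_def sum_nonneg)

lemma sq_norm_cong: "(\<And>a. a < m \<Longrightarrow> x a = y a) \<Longrightarrow> sq_norm m x = sq_norm m y"
  by (simp add: sq_norm_def)

lemma sqrt_sq_norm: "sqrt (sq_norm m x) = L2_set x {..<m}"
  by (simp add: sq_norm_def L2_set_def)

lemma mat_apply_cong:
  "A \<in> carrier_mat m m \<Longrightarrow> (\<And>a. a < m \<Longrightarrow> x a = y a) \<Longrightarrow> mat_apply A x = mat_apply A y"
  by (auto simp: mat_apply_def fun_eq_iff)

lemma inner_lin_comb:
  "(\<Sum>a<m. y a * lin_comb r c z a) = (\<Sum>i<r. (\<Sum>a<m. y a * z i a) * c i)"
proof -
  have "(\<Sum>a<m. y a * lin_comb r c z a) = (\<Sum>a<m. \<Sum>i<r. y a * z i a * c i)"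
    by (simp add: lin_comb_def sum_distrib_left mult_ac)
  also have "\<dots> = (\<Sum>i<r. \<Sum>a<m. y a * z i a * c i)" by (rule sum.swap)
  finally show ?thesis by (simp add: sum_distrib_right)
qed

lemma inner_lin_comb_orthonormal:
  assumes "orthonormal m r z" "i < r"
  shows "(\<Sum>a<m. z i a * lin_comb r c z a) = c i"
proof -
  have "(\<Sum>a<m. z i a * lin_comb r c z a) = (\<Sum>j<r. if i = j then c j else 0)"
    unfolding inner_lin_comb by (intro sum.cong refl) (simp add: orthonormalD[OF assms(1)] assms(2))
  then show ?thesis using assms(2) by simp
qed

lemma sq_norm_lin_comb:
  assumes "orthonormal m r z"
  shows "sq_norm m (lin_comb r c z) = (\<Sum>i<r. (c i)\<^sup>2)"
proof -
  have "sq_norm m (lin_comb r c z) = (\<Sum>a<m. lin_comb r c z a * lin_comb r c z a)"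
    by (simp add: sq_norm_def power2_eq_square)
  also have "\<dots> = (\<Sum>i<r. (\<Sum>a<m. z i a * lin_comb r c z a) * c i)"
    by (subst inner_lin_comb) (simp add: mult.commute)
  also have "\<dots> = (\<Sum>i<r. (c i)\<^sup>2)"
    by (simp add: inner_lin_comb_orthonormal[OF assms] power2_eq_square)
  finally show ?thesis .
qed

lemma mat_apply_lin_comb:
  assumes "A \<in> carrier_mat m m" "\<And>i. i < r \<Longrightarrow> mat_apply A (z i) a = \<mu> i * z i a"
  shows "mat_apply A (lin_comb r c z) a = lin_comb r (\<lambda>i. \<mu> i * c i) z a"
proof -
  have "mat_apply A (lin_comb r c z) a = (\<Sum>i<r. mat_apply A (z i) a * c i)"
    using assms(1) inner_lin_comb[of "\<lambda>b. A $$ (a, b)"] by (simp add: mat_apply_def)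
  then show ?thesis by (simp add: lin_comb_def assms(2) mult_ac)
qed

lemma sq_norm_mat_apply_lin_comb:
  assumes "A \<in> carrier_mat m m" "orthonormal m r z"
    "\<And>i a. i < r \<Longrightarrow> a < m \<Longrightarrow> mat_apply A (z i) a = \<mu> i * z i a"
  shows "sq_norm m (mat_apply A (lin_comb r c z)) = (\<Sum>i<r. (\<mu> i)\<^sup>2 * (c i)\<^sup>2)"
proof -
  have "sq_norm m (mat_apply A (lin_comb r c z)) = sq_norm m (lin_comb r (\<lambda>i. \<mu> i * c i) z)"
    by (intro sq_norm_cong mat_apply_lin_comb[OF assms(1)] assms(3))
  then show ?thesis by (simp add: sq_norm_lin_comb[OF assms(2)] power_mult_distrib)
qed

lemma sq_norm_mat_apply_ge:
  assumes "A \<in> carrier_mat m m" "orthonormal m r z"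
    "\<And>i a. i < r \<Longrightarrow> a < m \<Longrightarrow> mat_apply A (z i) a = \<mu> i * z i a"
    "0 \<le> s" "\<And>i. i < r \<Longrightarrow> s \<le> \<bar>\<mu> i\<bar>"
  shows "s\<^sup>2 * sq_norm m (lin_comb r c z) \<le> sq_norm m (mat_apply A (lin_comb r c z))"
proof -
  have "s\<^sup>2 * (c i)\<^sup>2 \<le> (\<mu> i)\<^sup>2 * (c i)\<^sup>2" if "i < r" for i
    using assms(4) assms(5)[OF that] by (intro mult_right_mono) (auto simp: abs_le_square_iff[symmetric])
  then have "s\<^sup>2 * (\<Sum>i<r. (c i)\<^sup>2) \<le> (\<Sum>i<r. (\<mu> i)\<^sup>2 * (c i)\<^sup>2)"
    unfolding sum_distrib_left by (intro sum_mono) simp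
  also have "\<dots> = sq_norm m (mat_apply A (lin_comb r c z))"
    by (intro sq_norm_mat_apply_lin_comb[symmetric] assms)
  finally show ?thesis by (simp add: sq_norm_lin_comb[OF assms(2)])
qed

text \<open>Orthonormality of the rows, \<open>U U\<^sup>T = 1\<close>, says that the columns \<open>u i\<close> span the space.\<close>
lemma orthonormal_basis_expansion:
  assumes "\<And>a b. a < m \<Longrightarrow> b < m \<Longrightarrow> (\<Sum>i<m. u i a * u i b) = (if a = b then 1 else 0)" "a < m"
  shows "lin_comb m (\<lambda>i. \<Sum>b<m. u i b * x b) u a = x a"
proof -
  have "lin_comb m (\<lambda>i. \<Sum>b<m. u i b * x b) u a = (\<Sum>i<m. \<Sum>b<m. u i b * u i a * x b)"
    by (simp add: lin_comb_def sum_distrib_left mult_ac)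
  also have "\<dots> = (\<Sum>b<m. (\<Sum>i<m. u i b * u i a) * x b)"
    unfolding sum_distrib_right by (rule sum.swap)
  also have "\<dots> = (\<Sum>b<m. if b = a then x b else 0)"
    by (intro sum.cong refl) (simp add: assms)
  finally show ?thesis using assms(2) by simp
qed

section \<open>Min-max estimates of singular values\<close>

text \<open>Padding the coefficients with zero rows gives a square matrix, which is singular.\<close>
lemma homogeneous_system_nontrivial_solution:
  fixes M :: "nat \<Rightarrow> nat \<Rightarrow> real"
  assumes "r < s"
  obtains c where "\<exists>i<s. c i \<noteq> 0" "\<And>q. q < r \<Longrightarrow> (\<Sum>i<s. M q i * c i) = 0"
proof -
  define P where "P = mat s s (\<lambda>(q, i). if q < r then M q i else 0)"
  have P: "P \<in> carrier_mat s s" by (simp add: P_def)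
  have "transpose_mat P *\<^sub>v unit_vec s r = 0\<^sub>v s"
    using assms by (intro eq_vecI) (auto simp: P_def scalar_prod_right_unit[of _ s])
  moreover have "unit_vec s r \<noteq> (0\<^sub>v s :: real vec)"
    using assms by (metis index_unit_vec(2) index_zero_vec(1) zero_neq_one)
  ultimately have "det (transpose_mat P) = 0"
    using P by (subst det_0_iff_vec_prod_zero[of _ s]) (auto intro!: exI[of _ "unit_vec s r"])
  then have "det P = 0" using det_transpose[OF P] by simp
  then obtain v where v: "v \<in> carrier_vec s" "v \<noteq> 0\<^sub>v s" "P *\<^sub>v v = 0\<^sub>v s"
    using det_0_iff_vec_prod_zero[OF P] by blast
  show thesis
  proof (rule that[of "\<lambda>i. v $ i"])
    show "\<exists>i<s. v $ i \<noteq> 0"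
    proof (rule ccontr)
      assume "\<not> ?thesis"
      then have "v = 0\<^sub>v s" using v(1) by (intro eq_vecI) auto
      then show False using v(2) by simp
    qed
    show "(\<Sum>i<s. M q i * v $ i) = 0" if "q < r" for q
      using arg_cong[OF v(3), of "\<lambda>y. y $ q"] that assms v(1)
      by (simp add: P_def scalar_prod_def lessThan_atLeast0)
  qed
qed

text \<open>
  The lower half of the Courant-Fischer principle, with \<open>p\<close> linear constraints. If \<open>A\<close> expands by
  at least \<open>s\<close> the vectors of a \<open>(j + p)\<close>-dimensional space that satisfy \<open>p\<close> equations, then
  \<open>\<sigma>\<^sub>j(A) \<ge> s\<close>: the further \<open>j - 1\<close> equations of being orthogonal to the first \<open>j - 1\<close> eigenvectors leave
  a nonzero solution, and \<open>A\<close> expands it by at most \<open>\<sigma>\<^sub>j(A)\<close>. Carrying the constraints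
  along avoids choosing an orthonormal basis of the constrained subspace.
\<close>
theorem singular_value_ge:
  assumes A: "A \<in> carrier_mat m m" "transpose_mat A = A" and j: "1 \<le> j" "j \<le> m"
    and z: "orthonormal m (j + p) z"
    and ge: "\<And>c. (\<And>q. q < p \<Longrightarrow> (\<Sum>a<m. w q a * lin_comb (j + p) c z a) = 0) \<Longrightarrow>
      s\<^sup>2 * sq_norm m (lin_comb (j + p) c z) \<le> sq_norm m (mat_apply A (lin_comb (j + p) c z))"
  shows "s \<le> sym_singular_value j A"
proof -
  obtain u l where u: "orthonormal m m u"
    "\<And>a b. a < m \<Longrightarrow> b < m \<Longrightarrow> (\<Sum>i<m. u i a * u i b) = (if a = b then 1 else 0)"
    "\<And>i a. i < m \<Longrightarrow> a < m \<Longrightarrow> mat_apply A (u i) a = l i * u i a"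
    "\<And>i. i < m \<Longrightarrow> sym_singular_value (Suc i) A = \<bar>l i\<bar>"
    "\<And>i j. i \<le> j \<Longrightarrow> j < m \<Longrightarrow> \<bar>l j\<bar> \<le> \<bar>l i\<bar>"
    using singular_values_eigenbasis[OF A] by blast
  define \<sigma> where "\<sigma> = sym_singular_value j A"
  have \<sigma>: "\<sigma> = \<bar>l (j - 1)\<bar>" using u(4)[of "j - 1"] j by (simp add: \<sigma>_def)
  define y where "y q = (if q < p then w q else u (q - p))" for q
  have "p + (j - 1) < j + p" using j by simp
  then obtain c where c: "\<exists>i<j + p. c i \<noteq> 0"
    "\<And>q. q < p + (j - 1) \<Longrightarrow> (\<Sum>i<j + p. (\<Sum>a<m. y q a * z i a) * c i) = 0"
    using homogeneous_system_nontrivial_solution[where M = "\<lambda>q i. \<Sum>a<m. y q a * z i a"] by blast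
  define x where "x = lin_comb (j + p) c z"
  have orth: "(\<Sum>a<m. y q a * x a) = 0" if "q < p + (j - 1)" for q
    unfolding x_def inner_lin_comb using c(2)[OF that] .
  have x_pos: "sq_norm m x > 0"
  proof -
    obtain i where "i < j + p" "c i \<noteq> 0" using c(1) by blast
    then show ?thesis unfolding x_def sq_norm_lin_comb[OF z] by (intro sum_pos2[of _ i]) auto
  qed
  have lower: "s\<^sup>2 * sq_norm m x \<le> sq_norm m (mat_apply A x)"
    unfolding x_def
  proof (rule ge)
    fix q assume "q < p"
    then show "(\<Sum>a<m. w q a * lin_comb (j + p) c z a) = 0"
      using orth[of q] by (simp add: y_def x_def)
  qed
  define d where "d i = (\<Sum>b<m. u i b * x b)" for i
  have d0: "d i = 0" if "i < j - 1" for i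
    using orth[of "p + i"] that by (simp add: d_def y_def)
  have x_eq: "lin_comb m d u a = x a" if "a < m" for a
    unfolding d_def by (rule orthonormal_basis_expansion) (use u(2) that in auto)
  have "sq_norm m (mat_apply A x) = (\<Sum>i<m. (l i)\<^sup>2 * (d i)\<^sup>2)"
    using sq_norm_mat_apply_lin_comb[OF A(1) u(1) u(3), of d] mat_apply_cong[OF A(1) x_eq] by simp
  also have "\<dots> \<le> (\<Sum>i<m. \<sigma>\<^sup>2 * (d i)\<^sup>2)"
  proof (rule sum_mono)
    fix i assume i: "i \<in> {..<m}"
    show "(l i)\<^sup>2 * (d i)\<^sup>2 \<le> \<sigma>\<^sup>2 * (d i)\<^sup>2"
    proof (cases "i < j - 1")
      case False
      then have "\<bar>l i\<bar> \<le> \<bar>l (j - 1)\<bar>" using i by (intro u(5)) auto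
      then show ?thesis unfolding \<sigma> by (intro mult_right_mono) (auto simp: abs_le_square_iff)
    qed (simp add: d0)
  qed
  also have "\<dots> = \<sigma>\<^sup>2 * sq_norm m x"
    using sq_norm_lin_comb[OF u(1), of d] sq_norm_cong[OF x_eq] by (simp add: sum_distrib_left)
  finally have "s\<^sup>2 * sq_norm m x \<le> \<sigma>\<^sup>2 * sq_norm m x" using lower by simp
  then have "s\<^sup>2 \<le> \<sigma>\<^sup>2" using x_pos by simp
  then have "\<bar>s\<bar> \<le> \<bar>\<sigma>\<bar>" by (simp add: abs_le_square_iff)
  then show ?thesis using \<sigma> unfolding \<sigma>_def[symmetric] by simp
qed

lemma singular_value_nonneg:
  assumes "A \<in> carrier_mat m m" "transpose_mat A = A" "1 \<le> j" "j \<le> m"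
  shows "0 \<le> sym_singular_value j A"
proof -
  obtain l where "\<And>i. i < m \<Longrightarrow> sym_singular_value (Suc i) A = \<bar>l i\<bar>"
    using singular_values_eigenbasis[OF assms(1,2)] by metis
  from this[of "j - 1"] show ?thesis using assms(3,4) by simp
qed

text \<open>
  A comparison on the hyperplane orthogonal to \<open>w\<close>, as arises from a perturbation of rank one, shifts
  the index by one. The test space is spanned by the first \<open>k + 1\<close> eigenvectors of \<open>A\<close>.
\<close>
lemma singular_value_interlacing:
  assumes A: "A \<in> carrier_mat m m" "transpose_mat A = A"
    and B: "B \<in> carrier_mat m m" "transpose_mat B = B" and k: "1 \<le> k" "Suc k \<le> m"
    and le: "\<And>x. (\<Sum>a<m. w a * x a) = 0 \<Longrightarrow>
      c\<^sup>2 * sq_norm m (mat_apply A x) \<le> sq_norm m (mat_apply B x)"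
  shows "c * sym_singular_value (Suc k) A \<le> sym_singular_value k B"
proof -
  obtain u l where u: "orthonormal m m u"
    "\<And>a b. a < m \<Longrightarrow> b < m \<Longrightarrow> (\<Sum>i<m. u i a * u i b) = (if a = b then 1 else 0)"
    "\<And>i a. i < m \<Longrightarrow> a < m \<Longrightarrow> mat_apply A (u i) a = l i * u i a"
    "\<And>i. i < m \<Longrightarrow> sym_singular_value (Suc i) A = \<bar>l i\<bar>"
    "\<And>i j. i \<le> j \<Longrightarrow> j < m \<Longrightarrow> \<bar>l j\<bar> \<le> \<bar>l i\<bar>"
    using singular_values_eigenbasis[OF A] by blast
  have u': "orthonormal m (k + 1) u" using orthonormal_mono[OF u(1)] k by simp
  have \<sigma>: "sym_singular_value (Suc k) A = \<bar>l k\<bar>" using u(4)[of k] k by simp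
  show ?thesis
  proof (rule singular_value_ge[OF B k(1) _ u', where w = "\<lambda>_. w"])
    fix d assume orth: "\<And>q :: nat. q < 1 \<Longrightarrow> (\<Sum>a<m. w a * lin_comb (k + 1) d u a) = 0"
    have perp: "(\<Sum>a<m. w a * lin_comb (k + 1) d u a) = 0" using orth[of 0] by simp
    have "\<bar>l k\<bar>\<^sup>2 * sq_norm m (lin_comb (k + 1) d u)
        \<le> sq_norm m (mat_apply A (lin_comb (k + 1) d u))"
      using k by (intro sq_norm_mat_apply_ge[OF A(1) u', where \<mu> = l] u(3)) (auto intro: u(5))
    then have "c\<^sup>2 * (\<bar>l k\<bar>\<^sup>2 * sq_norm m (lin_comb (k + 1) d u))
        \<le> c\<^sup>2 * sq_norm m (mat_apply A (lin_comb (k + 1) d u))"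
      by (intro mult_left_mono) auto
    then show "(c * sym_singular_value (Suc k) A)\<^sup>2 * sq_norm m (lin_comb (k + 1) d u)
        \<le> sq_norm m (mat_apply B (lin_comb (k + 1) d u))"
      using le[OF perp] by (simp add: \<sigma> power_mult_distrib)
  qed (use k in simp)
qed

text \<open>
  By Parseval's identity for the rows of \<open>A\<close>, the squared Frobenius norm is the sum of the squares of all
  singular values, and the first \<open>k\<close> of these are at least \<open>\<sigma>\<^sub>k(A)\<^sup>2\<close>.
\<close>
lemma singular_value_sq_le_Frobenius:
  assumes A: "A \<in> carrier_mat m m" "transpose_mat A = A" and k: "1 \<le> k" "k \<le> m"
  shows "real k * (sym_singular_value k A)\<^sup>2 \<le> (\<Sum>a<m. \<Sum>b<m. (A $$ (a, b))\<^sup>2)"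
proof -
  obtain u l where u: "orthonormal m m u"
    "\<And>a b. a < m \<Longrightarrow> b < m \<Longrightarrow> (\<Sum>i<m. u i a * u i b) = (if a = b then 1 else 0)"
    "\<And>i a. i < m \<Longrightarrow> a < m \<Longrightarrow> mat_apply A (u i) a = l i * u i a"
    "\<And>i. i < m \<Longrightarrow> sym_singular_value (Suc i) A = \<bar>l i\<bar>"
    "\<And>i j. i \<le> j \<Longrightarrow> j < m \<Longrightarrow> \<bar>l j\<bar> \<le> \<bar>l i\<bar>"
    using singular_values_eigenbasis[OF A] by blast
  have row: "(\<Sum>b<m. (A $$ (a, b))\<^sup>2) = (\<Sum>i<m. (l i * u i a)\<^sup>2)" if "a < m" for a
  proof -
    have coef: "(\<Sum>b<m. u i b * A $$ (a, b)) = l i * u i a" if "i < m" for i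
      using u(3)[OF that \<open>a < m\<close>] A(1) by (simp add: mat_apply_def mult.commute)
    have "(\<Sum>b<m. (A $$ (a, b))\<^sup>2) = sq_norm m (\<lambda>b. A $$ (a, b))"
      by (simp add: sq_norm_def)
    also have "\<dots> = sq_norm m (lin_comb m (\<lambda>i. \<Sum>b<m. u i b * A $$ (a, b)) u)"
      by (intro sq_norm_cong orthonormal_basis_expansion[symmetric] u(2))
    also have "\<dots> = (\<Sum>i<m. (l i * u i a)\<^sup>2)"
      unfolding sq_norm_lin_comb[OF u(1)] by (simp add: coef)
    finally show ?thesis .
  qed
  have "real k * (sym_singular_value k A)\<^sup>2 = (\<Sum>i<k. (l (k - 1))\<^sup>2)"
    using u(4)[of "k - 1"] k by simp
  also have "\<dots> \<le> (\<Sum>i<k. (l i)\<^sup>2)"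
    using k by (intro sum_mono) (auto simp: abs_le_square_iff[symmetric] intro!: u(5))
  also have "\<dots> \<le> (\<Sum>i<m. (l i)\<^sup>2)"
    using k by (intro sum_mono2) auto
  also have "\<dots> = (\<Sum>i<m. \<Sum>a<m. (l i * u i a)\<^sup>2)"
  proof (intro sum.cong refl)
    fix i assume "i \<in> {..<m}"
    then have "(\<Sum>a<m. (u i a)\<^sup>2) = 1"
      using orthonormalD[OF u(1), of i i] by (simp add: power2_eq_square)
    then show "(l i)\<^sup>2 = (\<Sum>a<m. (l i * u i a)\<^sup>2)"
      by (simp add: power_mult_distrib flip: sum_distrib_left)
  qed
  also have "\<dots> = (\<Sum>a<m. \<Sum>b<m. (A $$ (a, b))\<^sup>2)"
    by (subst sum.swap) (simp add: row)
  finally show ?thesis .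
qed

text \<open>
  If \<open>T - B\<close> has operator norm at most 1, then on the span of the given eigenvectors of \<open>T\<close> the triangle
  inequality shows that \<open>B\<close> expands by at least \<open>s - 1\<close>.
\<close>
lemma singular_value_ge_perturbed:
  assumes B: "B \<in> carrier_mat m m" "transpose_mat B = B" and j: "1 \<le> j" "j \<le> m"
    and T: "T \<in> carrier_mat m m" and z: "orthonormal m j z"
    and eig: "\<And>i a. i < j \<Longrightarrow> a < m \<Longrightarrow> mat_apply T (z i) a = \<mu> i * z i a"
    and \<mu>: "\<And>i. i < j \<Longrightarrow> s \<le> \<bar>\<mu> i\<bar>"
    and close: "\<And>x. sq_norm m (\<lambda>a. mat_apply T x a - mat_apply B x a) \<le> sq_norm m x"
  shows "s - 1 \<le> sym_singular_value j B"
proof (cases "s \<ge> 1")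
  case False
  \<comment> \<open>Squaring below needs \<open>s - 1 \<ge> 0\<close>.\<close>
  then show ?thesis using singular_value_nonneg[OF B j] by simp
next
  case True
  have z': "orthonormal m (j + 0) z" using z by simp
  show ?thesis
  proof (rule singular_value_ge[OF B j z', where w = "\<lambda>_ _. 0"])
    fix c
    define x where "x = lin_comb j c z"
    let ?N = "\<lambda>y. L2_set y {..<m}"
    have "s\<^sup>2 * sq_norm m x \<le> sq_norm m (mat_apply T x)"
      unfolding x_def using True by (intro sq_norm_mat_apply_ge[OF T z eig] \<mu>) auto
    then have "sqrt (s\<^sup>2 * sq_norm m x) \<le> sqrt (sq_norm m (mat_apply T x))"
      by (rule real_sqrt_le_mono)
    then have "s * ?N x \<le> ?N (mat_apply T x)"
      using True by (simp add: real_sqrt_mult sqrt_sq_norm)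
    also have "\<dots> \<le> ?N (mat_apply B x) + ?N (\<lambda>a. mat_apply T x a - mat_apply B x a)"
      using L2_set_triangle_ineq[of "mat_apply B x" "\<lambda>a. mat_apply T x a - mat_apply B x a"] by simp
    also have "?N (\<lambda>a. mat_apply T x a - mat_apply B x a) \<le> ?N x"
      using real_sqrt_le_mono[OF close[of x]] by (simp add: sqrt_sq_norm)
    finally have "(s - 1) * ?N x \<le> ?N (mat_apply B x)" by (simp add: algebra_simps)
    then have "((s - 1) * ?N x)\<^sup>2 \<le> (?N (mat_apply B x))\<^sup>2"
      using True by (intro power_mono) (auto simp: L2_set_nonneg)
    then show "(s - 1)\<^sup>2 * sq_norm m (lin_comb (j + 0) c z)
        \<le> sq_norm m (mat_apply B (lin_comb (j + 0) c z))"
      by (simp add: power_mult_distrib x_def flip: sqrt_sq_norm)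
  qed
qed

section \<open>The upper bound for graphs\<close>

text \<open>The sign matrix \<open>S = J - 2B\<close> acts as \<open>-2B\<close> on vectors with coordinate sum zero.\<close>
lemma singular_value_zero_one_mat_le:
  assumes B: "B \<in> carrier_mat m m" "transpose_mat B = B" and k: "1 \<le> k" "Suc k \<le> m"
    and B01: "\<And>a b. a < m \<Longrightarrow> b < m \<Longrightarrow> B $$ (a, b) \<in> {0, 1}"
  shows "sym_singular_value (Suc k) B \<le> real m / (2 * sqrt (real k))"
proof -
  define S where "S = mat m m (\<lambda>(a, b). 1 - 2 * B $$ (a, b))"
  have B_swap: "B $$ (a, b) = B $$ (b, a)" if "a < m" "b < m" for a b
    using arg_cong[OF B(2), of "\<lambda>M. M $$ (a, b)"] B(1) that by simp
  have S: "S \<in> carrier_mat m m" "transpose_mat S = S"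
    unfolding S_def by (auto intro!: eq_matI simp: B_swap)
  have "2 * sym_singular_value (Suc k) B \<le> sym_singular_value k S"
  proof (rule singular_value_interlacing[OF B S k, where w = "\<lambda>_. 1"])
    fix x :: "nat \<Rightarrow> real" assume "(\<Sum>a<m. 1 * x a) = 0"
    then have x: "(\<Sum>a<m. x a) = 0" by simp
    have "mat_apply S x a = - 2 * mat_apply B x a" if "a < m" for a
    proof -
      have "mat_apply S x a = (\<Sum>b<m. x b - 2 * (B $$ (a, b) * x b))"
        using that unfolding mat_apply_def S_def by (intro sum.cong) (auto simp: algebra_simps)
      then show ?thesis using x B(1) by (simp add: sum_subtractf sum_negf mat_apply_def sum_distrib_left)
    qed
    then have "sq_norm m (mat_apply S x) = sq_norm m (\<lambda>a. - 2 * mat_apply B x a)"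
      by (rule sq_norm_cong)
    also have "\<dots> = 2\<^sup>2 * sq_norm m (mat_apply B x)"
      by (simp add: sq_norm_def power_mult_distrib sum_distrib_left)
    finally show "2\<^sup>2 * sq_norm m (mat_apply B x) \<le> sq_norm m (mat_apply S x)" by simp
  qed
  moreover have "sym_singular_value k S \<le> real m / sqrt (real k)"
  proof -
    have "(S $$ (a, b))\<^sup>2 = 1" if "a < m" "b < m" for a b
      using B01[OF that] that unfolding S_def by auto
    then have "(\<Sum>a<m. \<Sum>b<m. (S $$ (a, b))\<^sup>2) = (real m)\<^sup>2"
      by (simp add: power2_eq_square)
    then have "real k * (sym_singular_value k S)\<^sup>2 \<le> (real m)\<^sup>2"
      using singular_value_sq_le_Frobenius[OF S k(1)] k(2) by simp
    then have "sqrt (real k * (sym_singular_value k S)\<^sup>2) \<le> sqrt ((real m)\<^sup>2)"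
      by (rule real_sqrt_le_mono)
    then have "sqrt (real k) * sym_singular_value k S \<le> real m"
      using singular_value_nonneg[OF S k(1)] k(2) by (simp add: real_sqrt_mult)
    then show ?thesis using k(1) by (simp add: field_simps)
  qed
  ultimately have "2 * sym_singular_value (Suc k) B \<le> real m / sqrt (real k)" by simp
  then show ?thesis using k(1) by (simp add: field_simps)
qed

lemma adjacency_mat_carrier: "adjacency_mat G \<in> carrier_mat (card (pverts G)) (card (pverts G))"
  by (simp add: adjacency_mat_def Let_def)

lemma adjacency_mat_zero_one:
  "a < card (pverts G) \<Longrightarrow> b < card (pverts G) \<Longrightarrow> adjacency_mat G $$ (a, b) \<in> {0, 1}"
  by (simp add: adjacency_mat_def Let_def)

lemma adjacency_mat_symmetric:
  assumes "pair_graph G"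
  shows "transpose_mat (adjacency_mat G) = adjacency_mat G"
proof -
  interpret pair_graph G by fact
  have "(a, b) \<in> parcs G \<longleftrightarrow> (b, a) \<in> parcs G" for a b
    using pair_sym_arcs by (auto simp: symmetric_def sym_def)
  then show ?thesis by (intro eq_matI) (auto simp: adjacency_mat_def Let_def)
qed

lemma graph_singular_value_le:
  assumes "pair_graph G" "1 \<le> k" "Suc k \<le> card (pverts G)"
  shows "graph_singular_value (Suc k) G / real (card (pverts G)) \<le> 1 / (2 * sqrt (real k))"
proof -
  have "graph_singular_value (Suc k) G \<le> real (card (pverts G)) / (2 * sqrt (real k))"
    unfolding graph_singular_value_def
    using singular_value_zero_one_mat_le[OF adjacency_mat_carrier adjacency_mat_symmetric[OF assms(1)]
        assms(2,3) adjacency_mat_zero_one] .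
  then show ?thesis using assms(2,3) by (simp add: field_simps)
qed

section \<open>Graphs from sign matrices\<close>

text \<open>
  Indices of the blown-up matrix are split as \<open>p = q n + a\<close>, with block number \<open>q\<close> and position \<open>a\<close>.
\<close>
lemma sum_mod_div:
  fixes f :: "nat \<Rightarrow> nat \<Rightarrow> real"
  shows "(\<Sum>p<r * n. f (p mod n) (p div n)) = (\<Sum>q<r. \<Sum>a<n. f a q)"
proof -
  have "(\<Sum>p\<in>{q * n..<q * n + n}. f (p mod n) (p div n)) = (\<Sum>a<n. f a q)" for q
  proof -
    have "(\<Sum>p\<in>{q * n..<q * n + n}. f (p mod n) (p div n))
        = (\<Sum>a<n. f ((a + q * n) mod n) ((a + q * n) div n))"
      using sum.shift_bounds_nat_ivl[of "\<lambda>p. f (p mod n) (p div n)" 0 "q * n" n]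
      by (simp add: lessThan_atLeast0 add.commute)
    also have "\<dots> = (\<Sum>a<n. f a q)" by (intro sum.cong refl) auto
    finally show ?thesis .
  qed
  then show ?thesis by (simp flip: sum.nat_group)
qed

lemma sum_alternating: "(\<Sum>q<2 * t. (- 1) ^ q) = (0 :: real)"
proof (induction t)
  case (Suc t)
  have "2 * Suc t = Suc (Suc (2 * t))" by simp
  then show ?case using Suc by simp
qed simp

text \<open>
  The blow-up \<open>S = v v\<^sup>T \<otimes> A\<close> with \<open>v = (1, -1, 1, -1, \<dots>)\<close> of length \<open>r = 2t\<close>. An eigenvector \<open>u\<close> of \<open>A\<close> with
  eigenvalue \<open>\<lambda>\<close> yields the eigenvector \<open>v \<otimes> u\<close> of \<open>S\<close> with eigenvalue \<open>r \<lambda>\<close>. It is orthogonal to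
  the all-ones vector, which \<open>S\<close> annihilates, and so all these vectors are simultaneously
  eigenvectors of \<open>(J + S) / 2\<close>.
\<close>
lemma exists_graph_large_singular_value:
  assumes A: "A \<in> carrier_mat n n" "transpose_mat A = A" "elements_mat A \<subseteq> {-1, 1}"
    and k: "1 \<le> k" "k \<le> n" and sv: "sym_singular_value k A = real n / sqrt (real k)" and t: "1 \<le> t"
  obtains G where "pair_graph G" "card (pverts G) = 2 * t * n"
    "graph_singular_value (Suc k) G \<ge> real (2 * t * n) / (2 * sqrt (real k)) - 1"
proof -
  define r m where "r = 2 * t" and "m = r * n"
  have n0: "n > 0" and r0: "r > 0" and m0: "m > 0" using k t by (auto simp: r_def m_def)
  define sg :: "nat \<Rightarrow> real" where "sg p = (- 1) ^ (p div n)" for p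
  define S where "S p q = A $$ (p mod n, q mod n) * sg p * sg q" for p q
  have A_swap: "A $$ (a, b) = A $$ (b, a)" if "a < n" "b < n" for a b
    using arg_cong[OF A(2), of "\<lambda>M. M $$ (a, b)"] A(1) that by simp
  have A_pm: "A $$ (a, b) \<in> {-1, 1}" if "a < n" "b < n" for a b
  proof -
    have "A $$ (a, b) \<in> elements_mat A" using A(1) that by (intro elements_matI) auto
    then show ?thesis using A(3) by blast
  qed
  have S_swap: "S p q = S q p" for p q
    using A_swap[of "p mod n" "q mod n"] n0 by (simp add: S_def)
  have sg_pm: "sg p = 1 \<or> sg p = - 1" for p
    unfolding sg_def by (cases "even (p div n)") auto
  have sg_sq: "sg p * sg p = 1" for p using sg_pm[of p] by auto
  have S_pm: "S p q = 1 \<or> S p q = - 1" for p q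
    using A_pm[of "p mod n" "q mod n"] n0 sg_pm[of p] sg_pm[of q] unfolding S_def by auto
  have sum_sg: "(\<Sum>q<r. (- 1) ^ q) = (0 :: real)" unfolding r_def by (rule sum_alternating)

  define G :: "nat pair_pre_digraph" where
    "G = \<lparr>pverts = {..<m}, parcs = {(p, q). p < m \<and> q < m \<and> p \<noteq> q \<and> S p q = 1}\<rparr>"
  have fin: "finite (parcs G)"
    by (rule finite_subset[of _ "{..<m} \<times> {..<m}"]) (auto simp: G_def)
  have G: "pair_graph G"
    by unfold_locales (use fin S_swap in \<open>auto simp: G_def symmetric_def sym_def\<close>)
  define B where "B = adjacency_mat G"
  have cardG: "card (pverts G) = m" by (simp add: G_def)
  have B: "B \<in> carrier_mat m m" "transpose_mat B = B"
    unfolding B_def using adjacency_mat_carrier[of G] adjacency_mat_symmetric[OF G] by (auto simp: cardG)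
  have B_entry: "B $$ (p, q) = (if p \<noteq> q \<and> S p q = 1 then 1 else 0)" if "p < m" "q < m" for p q
    using that by (simp add: B_def adjacency_mat_def G_def lessThan_atLeast0 Let_def)

  \<comment> \<open>\<open>(J + S) / 2\<close>, which differs from \<open>B\<close> on the diagonal only\<close>
  define T where "T = mat m m (\<lambda>(p, q). (1 + S p q) / 2)"
  have T: "T \<in> carrier_mat m m" by (simp add: T_def)
  have T_apply: "mat_apply T x p = ((\<Sum>q<m. x q) + sg p * (\<Sum>q<m. A $$ (p mod n, q mod n) * sg q * x q)) / 2"
    if "p < m" for x p
  proof -
    have "mat_apply T x p = (\<Sum>q<m. (x q + sg p * (A $$ (p mod n, q mod n) * sg q * x q)) / 2)"
      unfolding mat_apply_def T_def S_def using that
      by (intro sum.cong) (auto simp: field_simps)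
    then show ?thesis by (simp add: sum.distrib sum_distrib_left flip: sum_divide_distrib)
  qed

  obtain u l where u: "orthonormal n n u"
    "\<And>a b. a < n \<Longrightarrow> b < n \<Longrightarrow> (\<Sum>i<n. u i a * u i b) = (if a = b then 1 else 0)"
    "\<And>i a. i < n \<Longrightarrow> a < n \<Longrightarrow> mat_apply A (u i) a = l i * u i a"
    "\<And>i. i < n \<Longrightarrow> sym_singular_value (Suc i) A = \<bar>l i\<bar>"
    "\<And>i j. i \<le> j \<Longrightarrow> j < n \<Longrightarrow> \<bar>l j\<bar> \<le> \<bar>l i\<bar>"
    using singular_values_eigenbasis[OF A(1,2)] by blast
  have l_ge: "real n / sqrt (real k) \<le> \<bar>l i\<bar>" if "i < k" for i
    using u(4)[of "k - 1"] u(5)[of i "k - 1"] sv k that by simp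

  \<comment> \<open>The normalised all-ones vector, followed by the normalised \<open>v \<otimes> u\<^sub>i\<close>, and their eigenvalues.\<close>
  define z where "z i p = (if i = 0 then 1 / sqrt (real m)
      else u (i - 1) (p mod n) * sg p / sqrt (real r))" for i p
  define \<mu> where "\<mu> i = (if i = 0 then real m / 2 else real r * l (i - 1) / 2)" for i
  have sum_u_sg: "(\<Sum>p<m. u i (p mod n) * sg p) = 0" for i
  proof -
    have "(\<Sum>p<m. u i (p mod n) * sg p) = (\<Sum>q<r. \<Sum>a<n. u i a * (- 1) ^ q)"
      unfolding sg_def m_def by (rule sum_mod_div[of "\<lambda>a q. u i a * (- 1) ^ q"])
    also have "\<dots> = (\<Sum>q<r. (- 1) ^ q) * (\<Sum>a<n. u i a)"
      unfolding sum_product by (simp add: mult.commute)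
    finally show ?thesis by (simp add: sum_sg)
  qed
  have z_orth: "orthonormal m (Suc k) z"
    unfolding orthonormal_def
  proof (intro allI impI)
    fix i j assume ij: "i < Suc k" "j < Suc k"
    consider "i = 0" "j = 0" | "i = 0" "j > 0" | "i > 0" "j = 0" | "i > 0" "j > 0" by auto
    then show "(\<Sum>p<m. z i p * z j p) = (if i = j then 1 else 0)"
    proof cases
      case 1
      then show ?thesis using m0 by (simp add: z_def)
    next
      case 2
      then have "(\<Sum>p<m. z i p * z j p)
          = (\<Sum>p<m. u (j - 1) (p mod n) * sg p) * (1 / (sqrt (real m) * sqrt (real r)))"
        unfolding sum_distrib_right by (simp add: z_def)
      then show ?thesis using 2 by (simp add: sum_u_sg)
    next
      case 3
      then have "(\<Sum>p<m. z i p * z j p)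
          = (\<Sum>p<m. u (i - 1) (p mod n) * sg p) * (1 / (sqrt (real m) * sqrt (real r)))"
        unfolding sum_distrib_right by (simp add: z_def mult.commute)
      then show ?thesis using 3 by (simp add: sum_u_sg)
    next
      case 4
      have "z i p * z j p = u (i - 1) (p mod n) * u (j - 1) (p mod n) / real r" for p
      proof -
        have "z i p * z j p = u (i - 1) (p mod n) * u (j - 1) (p mod n) * (sg p * sg p)
            / (sqrt (real r) * sqrt (real r))"
          using 4 by (simp add: z_def mult_ac)
        then show ?thesis by (simp add: sg_sq)
      qed
      then have "(\<Sum>p<m. z i p * z j p)
          = (\<Sum>p<m. u (i - 1) (p mod n) * u (j - 1) (p mod n) / real r)" by simp
      also have "\<dots> = (\<Sum>q<r. \<Sum>a<n. u (i - 1) a * u (j - 1) a / real r)"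
        unfolding m_def by (rule sum_mod_div[of "\<lambda>a q. u (i - 1) a * u (j - 1) a / real r"])
      also have "\<dots> = (\<Sum>a<n. u (i - 1) a * u (j - 1) a)"
        using r0 by (simp flip: sum_divide_distrib)
      also have "\<dots> = (if i - 1 = j - 1 then 1 else 0)"
        using 4 ij k by (intro orthonormalD[OF u(1)]) auto
      finally show ?thesis using 4 by auto
    qed
  qed
  have z_eig: "mat_apply T (z i) p = \<mu> i * z i p" if "i < Suc k" "p < m" for i p
  proof (cases "i = 0")
    case True
    have "(\<Sum>q<m. A $$ (p mod n, q mod n) * sg q) = (\<Sum>q<r. \<Sum>a<n. A $$ (p mod n, a) * (- 1) ^ q)"
      unfolding sg_def m_def by (rule sum_mod_div[of "\<lambda>a q. A $$ (p mod n, a) * (- 1) ^ q"])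
    also have "\<dots> = (\<Sum>q<r. (- 1) ^ q) * (\<Sum>a<n. A $$ (p mod n, a))"
      unfolding sum_product by (simp add: mult.commute)
    finally have "(\<Sum>q<m. A $$ (p mod n, q mod n) * sg q) = 0" by (simp add: sum_sg)
    then have "(\<Sum>q<m. A $$ (p mod n, q mod n) * sg q * z 0 q) = 0"
      by (simp add: z_def flip: sum_divide_distrib)
    then show ?thesis unfolding T_apply[OF that(2)] using True by (simp add: z_def \<mu>_def)
  next
    case False
    have "(\<Sum>q<m. z i q) = 0"
      using False sum_u_sg[of "i - 1"] by (simp add: z_def flip: sum_divide_distrib)
    moreover have "(\<Sum>q<m. A $$ (p mod n, q mod n) * sg q * z i q)
        = real r * l (i - 1) * u (i - 1) (p mod n) / sqrt (real r)"
    proof -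
      have "(\<Sum>q<m. A $$ (p mod n, q mod n) * sg q * z i q)
          = (\<Sum>q<m. A $$ (p mod n, q mod n) * u (i - 1) (q mod n) * (sg q * sg q) / sqrt (real r))"
        using False by (simp add: z_def mult_ac)
      also have "\<dots> = (\<Sum>q<m. A $$ (p mod n, q mod n) * u (i - 1) (q mod n) / sqrt (real r))"
        by (simp add: sg_sq)
      also have "\<dots> = (\<Sum>q<r. \<Sum>a<n. A $$ (p mod n, a) * u (i - 1) a / sqrt (real r))"
        unfolding m_def
        by (rule sum_mod_div[of "\<lambda>a q. A $$ (p mod n, a) * u (i - 1) a / sqrt (real r)"])
      also have "\<dots> = real r * mat_apply A (u (i - 1)) (p mod n) / sqrt (real r)"
        using A(1) by (simp add: mat_apply_def flip: sum_divide_distrib)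
      finally show ?thesis using u(3)[of "i - 1" "p mod n"] that(1) False k n0 by simp
    qed
    ultimately show ?thesis
      unfolding T_apply[OF that(2)] using False by (simp add: z_def \<mu>_def mult_ac)
  qed
  have \<mu>_ge: "real m / (2 * sqrt (real k)) \<le> \<bar>\<mu> i\<bar>" if "i < Suc k" for i
  proof (cases "i = 0")
    case True
    have "1 \<le> sqrt (real k)" using k by simp
    then have "real m / (2 * sqrt (real k)) \<le> real m / 2" by (intro divide_left_mono) auto
    then show ?thesis using True by (simp add: \<mu>_def)
  next
    case False
    then have "real r / 2 * (real n / sqrt (real k)) \<le> real r / 2 * \<bar>l (i - 1)\<bar>"
      using l_ge[of "i - 1"] that by (intro mult_left_mono) auto
    then show ?thesis using False by (simp add: \<mu>_def m_def abs_mult)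
  qed
  have close: "sq_norm m (\<lambda>p. mat_apply T x p - mat_apply B x p) \<le> sq_norm m x" for x
  proof -
    have "(mat_apply T x p - mat_apply B x p)\<^sup>2 \<le> (x p)\<^sup>2" if p: "p < m" for p
    proof -
      have "mat_apply T x p - mat_apply B x p = (\<Sum>q<m. (T $$ (p, q) - B $$ (p, q)) * x q)"
        using T B(1) by (simp add: mat_apply_def algebra_simps flip: sum_subtractf)
      also have "\<dots> = (\<Sum>q<m. if q = p then T $$ (p, p) * x p else 0)"
      proof (intro sum.cong refl)
        fix q assume "q \<in> {..<m}"
        then show "(T $$ (p, q) - B $$ (p, q)) * x q = (if q = p then T $$ (p, p) * x p else 0)"
          using p S_pm[of p q] by (auto simp: B_entry T_def)
      qed
      also have "\<dots> = T $$ (p, p) * x p" using p by simp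
      finally have "mat_apply T x p - mat_apply B x p = T $$ (p, p) * x p" .
      moreover have "T $$ (p, p) = 0 \<or> T $$ (p, p) = 1" using p S_pm[of p p] by (auto simp: T_def)
      ultimately show ?thesis by auto
    qed
    then show ?thesis unfolding sq_norm_def by (intro sum_mono) auto
  qed
  \<comment> \<open>The even blow-up factor provides room for one more singular value than \<open>A\<close> may have.\<close>
  have "Suc k \<le> m"
  proof -
    have "Suc k \<le> 2 * n" using k by simp
    also have "\<dots> \<le> m" using t unfolding m_def r_def by simp
    finally show ?thesis .
  qed
  then have "real m / (2 * sqrt (real k)) - 1 \<le> sym_singular_value (Suc k) B"
    by (intro singular_value_ge_perturbed[OF B _ _ T z_orth z_eig \<mu>_ge close]) auto
  then show thesis
    using that[OF G] cardG by (simp add: graph_singular_value_def B_def m_def r_def)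
qed

section \<open>The extremal constant\<close>

theorem theorem2p13:
  fixes n k :: nat and A :: "real mat"
  assumes "1 \<le> k" and "k \<le> n"
    and "A \<in> carrier_mat n n" and "transpose_mat A = A" and "elements_mat A \<subseteq> {-1, 1}"
    and "sym_singular_value k A = real n / sqrt (real k)"
  shows "c_star (k + 1) = 1 / (2 * sqrt (real k))"
proof -
  define X where "X = {graph_singular_value (k + 1) G / real (card (pverts G)) | G.
    pair_graph G \<and> card (pverts G) \<ge> k + 1}"
  define c where "c = 1 / (2 * sqrt (real k))"
  have upper: "x \<le> c" if "x \<in> X" for x
    using that graph_singular_value_le assms(1) unfolding X_def c_def by auto
  have lower: "\<exists>x\<in>X. c - 1 / real (Suc t) \<le> x" for t
  proof -
    define m where "m = 2 * Suc t * n"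
    obtain G where G: "pair_graph G" "card (pverts G) = m"
      "graph_singular_value (Suc k) G \<ge> real m / (2 * sqrt (real k)) - 1"
      using exists_graph_large_singular_value[OF assms(3-5,1,2,6), of "Suc t"]
      unfolding m_def by auto
    have n: "n \<ge> 1" using assms(1,2) by simp
    then have "Suc t * 1 \<le> Suc t * (2 * n)" by (intro mult_le_mono2) simp
    then have tm: "Suc t \<le> m" by (simp add: m_def mult_ac)
    have "2 * n * 1 \<le> 2 * n * Suc t" by (intro mult_le_mono2) simp
    then have km: "k + 1 \<le> m" using assms(1,2) by (simp add: m_def mult_ac)
    have "c - 1 / real (Suc t) \<le> c - 1 / real m"
      using tm by (simp add: frac_le)
    also have "\<dots> = (real m / (2 * sqrt (real k)) - 1) / real m"
      using tm by (simp add: c_def diff_divide_distrib)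
    also have "\<dots> \<le> graph_singular_value (k + 1) G / real m"
      using G(3) by (intro divide_right_mono) auto
    finally show ?thesis using G(1,2) km unfolding X_def by auto
  qed
  have "X \<noteq> {}" using lower[of 0] by auto
  have bdd: "bdd_above X" using upper by (intro bdd_aboveI)
  have "Sup X = c"
  proof (rule antisym)
    show "Sup X \<le> c" using \<open>X \<noteq> {}\<close> upper by (rule cSup_least)
    show "c \<le> Sup X"
    proof (rule field_le_epsilon)
      fix e :: real assume "e > 0"
      then obtain t where "inverse (real (Suc t)) < e" using reals_Archimedean by blast
      then have t: "1 / real (Suc t) < e" by (simp only: inverse_eq_divide)
      obtain x where "x \<in> X" "c - 1 / real (Suc t) \<le> x" using lower[of t] by blast
      then show "c \<le> Sup X + e" using cSup_upper[OF _ bdd, of x] t by simp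
    qed
  qed
  then show ?thesis unfolding c_star_def X_def c_def .
qed

end
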